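(* Let $r$, $s$ and $t$ be any integers and let $n$ be a non-negative integer. Then $$\sum_{k=0}^n \binom{n}{k} \frac{1}{k+2} (-1)^{r(n-k)} F_{r}^{k+2} F_s^{n-k} F_{s(k+2)-r(n-k)+t} = \frac{1}{(n+1)(n+2)}\Big( (-1)^{t+1} F_s^{n+2} F_{r(n+2)-t} - F_t F_{r+s}^{n+2} \Big) + \frac{1}{n+1} F_r F_{s+t} F_{r+s}^{n+1}$$ and $$\sum_{k=0}^n \binom{n}{k} \frac{1}{k+2} (-1)^{r(n-k)} F_{r}^{k+2} F_s^{n-k} L_{s(k+2)-r(n-k)+t} = \frac{1}{(n+1)(n+2)}\Big( (-1)^t F_s^{n+2} L_{r(n+2)-t} - L_t F_{r+s}^{n+2} \Big) + \frac{1}{n+1} F_r L_{s+t} F_{r+s}^{n+1}.$$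
   Context: $F_m$ and $L_m$ denote the Fibonacci and Lucas numbers, defined for all integers $m$ by the recurrence $x_m = x_{m-1}+x_{m-2}$ with $F_0=0$, $F_1=1$ and $L_0=2$, $L_1=1$. In particular $F_{-m}=(-1)^{m-1}F_m$ and $L_{-m}=(-1)^m L_m$. The convention $x^0=1$ (also for $x=0$) is used. *)

theory Defs
  imports Complex_Main "HOL-Number_Theory.Fib"
begin

text \<open>
  The library's \<^const>\<open>fib\<close> is indexed by natural numbers. Here the recurrence
  \<open>x m = x (m - 1) + x (m - 2)\<close> is run upwards for \<open>m > 1\<close> and, solved for its last term,
  downwards for \<open>m < 0\<close>; the lemmas below recover the recurrence on all integers.
\<close>

function fibz :: "int \<Rightarrow> int" where
  "fibz m =
     (if m = 0 then 0
      else if m = 1 then 1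
      else if m > 1 then fibz (m - 1) + fibz (m - 2)
      else fibz (m + 2) - fibz (m + 1))"
  by auto
termination
  by (relation "measure (\<lambda>m. if m \<ge> 0 then nat m else nat (2 - m))") auto

function lucasz :: "int \<Rightarrow> int" where
  "lucasz m =
     (if m = 0 then 2
      else if m = 1 then 1
      else if m > 1 then lucasz (m - 1) + lucasz (m - 2)
      else lucasz (m + 2) - lucasz (m + 1))"
  by auto
termination
  by (relation "measure (\<lambda>m. if m \<ge> 0 then nat m else nat (2 - m))") auto

text \<open>The unconditional defining equations loop as rewrite rules.\<close>

declare fibz.simps [simp del] lucasz.simps [simp del]

lemma fibz_0 [simp]: "fibz 0 = 0"
  and fibz_1 [simp]: "fibz 1 = 1"
  by (simp_all add: fibz.simps)

lemma lucasz_0 [simp]: "lucasz 0 = 2"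
  and lucasz_1 [simp]: "lucasz 1 = 1"
  by (simp_all add: lucasz.simps)

lemma fibz_rec: "fibz m = fibz (m - 1) + fibz (m - 2)"
proof (cases "m > 1")
  case True
  then show ?thesis by (subst fibz.simps) simp
next
  case False
  then have "fibz (m - 2) = fibz m - fibz (m - 1)"
    by (subst fibz.simps) simp
  then show ?thesis by simp
qed

lemma lucasz_rec: "lucasz m = lucasz (m - 1) + lucasz (m - 2)"
proof (cases "m > 1")
  case True
  then show ?thesis by (subst lucasz.simps) simp
next
  case False
  then have "lucasz (m - 2) = lucasz m - lucasz (m - 1)"
    by (subst lucasz.simps) simp
  then show ?thesis by simp
qed

lemma fibz_of_nat: "fibz (int n) = int (fib n)"
proof (induction n rule: fib.induct)
  case (3 n)
  have "fibz (int (Suc (Suc n))) = fibz (int (Suc n)) + fibz (int n)"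
    using fibz_rec [of "int (Suc (Suc n))"] by simp
  then show ?case using 3 by simp
qed simp_all

end

theory Submission
  imports Defs
begin

text \<open>
  With \<open>\<phi>\<close>, \<open>\<psi>\<close> the roots of \<open>x\<^sup>2 = x + 1\<close>, Binet's formula gives
  \<open>F\<^bsub>r+s\<^esub> = F\<^sub>r \<phi>\<^sup>s + F\<^sub>s \<psi>\<^sup>r\<close>, and the same with \<open>\<phi>\<close> and \<open>\<psi>\<close> exchanged.
  Put \<open>a = F\<^sub>r \<phi>\<^sup>s\<close> and \<open>b = F\<^sub>s \<psi>\<^sup>r = (-1)\<^sup>r F\<^sub>s \<phi>\<^bsup>-r\<^esup>\<close>, so that \<open>a + b = F\<^bsub>r+s\<^esub>\<close>.
  Since \<open>(n choose k) / (k + 2) = (k + 1) (n + 2 choose k + 2) / ((n + 1) (n + 2))\<close>,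
  the binomial theorem and its derivative give a closed form of
  \<open>\<Sum>k. (n choose k) a\<^bsup>k+2\<^esup> b\<^bsup>n-k\<^esup> / (k + 2)\<close>.
  Multiply it by \<open>\<phi>\<^sup>t\<close>; the difference and the sum of this identity and its conjugate are the
  Fibonacci and the Lucas identity.
\<close>

lemma binomial_absorb2:
  "real (n choose k) / (real k + 2) =
     (real k + 1) * real (Suc (Suc n) choose Suc (Suc k)) / ((real n + 1) * (real n + 2))"
proof -
  have "(real k + 2) * real (Suc (Suc n) choose Suc (Suc k)) = (real n + 2) * real (Suc n choose Suc k)"
    using arg_cong [OF Suc_times_binomial_eq [of "Suc n" "Suc k"], of real]
    by (simp add: algebra_simps del: binomial_Suc_Suc)
  moreover have "(real k + 1) * real (Suc n choose Suc k) = (real n + 1) * real (n choose k)"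
    using arg_cong [OF Suc_times_binomial_eq [of n k], of real]
    by (simp add: algebra_simps del: binomial_Suc_Suc)
  ultimately have "(real k + 2) * ((real k + 1) * real (Suc (Suc n) choose Suc (Suc k)))
      = (real n + 2) * ((real n + 1) * real (n choose k))"
    by (metis mult.left_commute)
  moreover have "real k + 2 \<noteq> 0" "real n + 1 \<noteq> 0" "real n + 2 \<noteq> 0"
    by linarith+
  ultimately show ?thesis
    by (simp add: frac_eq_eq mult_ac del: binomial_Suc_Suc)
qed

lemma sum_index_binomial:
  fixes a b :: real
  shows "(\<Sum>j\<le>Suc m. real j * real (Suc m choose j) * a ^ j * b ^ (Suc m - j))
     = real (Suc m) * a * (a + b) ^ m"
proof -
  have "(\<Sum>j\<le>Suc m. real j * real (Suc m choose j) * a ^ j * b ^ (Suc m - j))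
      = (\<Sum>i\<le>m. real (Suc i) * real (Suc m choose Suc i) * a ^ Suc i * b ^ (m - i))"
    by (subst sum.atMost_Suc_shift) simp
  also have "\<dots> = (\<Sum>i\<le>m. real (Suc m) * a * (real (m choose i) * a ^ i * b ^ (m - i)))"
  proof (rule sum.cong [OF refl])
    fix i
    have "real (Suc i) * real (Suc m choose Suc i) = real (Suc m) * real (m choose i)"
      using Suc_times_binomial_eq [of m i] by (metis mult.commute of_nat_mult)
    then show "real (Suc i) * real (Suc m choose Suc i) * a ^ Suc i * b ^ (m - i)
        = real (Suc m) * a * (real (m choose i) * a ^ i * b ^ (m - i))"
      by (simp del: binomial_Suc_Suc of_nat_Suc)
  qed
  also have "\<dots> = real (Suc m) * a * (a + b) ^ m"
    by (simp add: binomial_ring sum_distrib_left)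
  finally show ?thesis .
qed

lemma sum_binomial_div_add2:
  fixes a b :: real
  shows "(\<Sum>k\<le>n. real (n choose k) / (real k + 2) * a ^ (k + 2) * b ^ (n - k))
     = (b ^ (n + 2) - (a + b) ^ (n + 2)) / ((real n + 1) * (real n + 2))
       + a * (a + b) ^ (n + 1) / (real n + 1)"
proof -
  define N where "N = Suc (Suc n)"
  \<comment> \<open>With \<open>j = k + 2\<close>, the factor \<open>k + 1\<close> from
    \<open>binomial_absorb2\<close> becomes \<open>j - 1\<close>. Summed over all \<open>j\<close>,
    it splits into the differentiated and the plain binomial theorem.\<close>
  define h where "h j = (real j - 1) * real (N choose j) * a ^ j * b ^ (N - j)" for j
  have "(\<Sum>j\<le>N. h j) = real N * a * (a + b) ^ (n + 1) - (a + b) ^ N"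
    using sum_index_binomial [of "Suc n" a b]
    by (simp add: h_def N_def binomial_ring sum_subtractf left_diff_distrib
        del: binomial_Suc_Suc sum.atMost_Suc power_Suc)
  \<comment> \<open>Only the first two terms are lost by the shift: \<open>h 0 = - (b ^ N)\<close>
    and \<open>h 1 = 0\<close>.\<close>
  moreover have "(\<Sum>j\<le>N. h j) = (\<Sum>k\<le>n. h (Suc (Suc k))) - b ^ N"
    by (simp add: N_def h_def sum.atMost_Suc_shift del: sum.atMost_Suc)
  ultimately have h_sum:
    "(\<Sum>k\<le>n. h (Suc (Suc k))) = real N * a * (a + b) ^ (n + 1) + b ^ N - (a + b) ^ N"
    by simp
  have "(\<Sum>k\<le>n. real (n choose k) / (real k + 2) * a ^ (k + 2) * b ^ (n - k))
      = (\<Sum>k\<le>n. h (Suc (Suc k)) / ((real n + 1) * (real n + 2)))"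
    by (simp add: binomial_absorb2 h_def N_def algebra_simps del: binomial_Suc_Suc)
  also have "\<dots> = (real N * a * (a + b) ^ (n + 1) + b ^ N - (a + b) ^ N)
      / ((real n + 1) * (real n + 2))"
    by (simp only: h_sum sum_divide_distrib [symmetric])
  also have "\<dots> = (b ^ (n + 2) - (a + b) ^ (n + 2)) / ((real n + 1) * (real n + 2))
      + (real n + 2) * (a * (a + b) ^ (n + 1)) / ((real n + 2) * (real n + 1))"
    by (simp add: N_def add_divide_distrib diff_divide_distrib algebra_simps)
  also have "(real n + 2) * (a * (a + b) ^ (n + 1)) / ((real n + 2) * (real n + 1))
      = a * (a + b) ^ (n + 1) / (real n + 1)"
    by (rule mult_divide_mult_cancel_left) linarith
  finally show ?thesis .
qed

lemma powi_conjugate: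
  fixes x y :: real
  assumes "x * y = -1"
  shows "y powi m = (-1) powi m * x powi (- m)"
proof -
  have "x \<noteq> 0" using assms by auto
  then have "y = -1 * inverse x" using assms by (simp add: field_simps)
  then show ?thesis
    by (simp only: power_int_mult_distrib power_int_inverse power_int_minus)
qed

text \<open>The case \<open>a = p * x powi s\<close>, \<open>b = q * y powi r\<close> of
  \<open>sum_binomial_div_add2\<close>, multiplied by \<open>x powi t\<close>. Keeping
  \<open>x\<close> and \<open>y\<close> abstract lets one proof serve both \<open>(phi, psi)\<close>
  and \<open>(psi, phi)\<close>.\<close>

lemma sum_binomial_powi:
  fixes x y p q c :: real and r s t :: int
  assumes xy: "x * y = -1" and c: "c = p * x powi s + q * y powi r"
  shows "(\<Sum>k=0..n. real (n choose k) * (1 / (real k + 2))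
         * (-1) powi (r * (int n - int k)) * p ^ (k + 2) * q ^ (n - k)
         * x powi (s * (int k + 2) - r * (int n - int k) + t))
     = 1 / ((real n + 1) * (real n + 2))
         * ((-1) powi t * q ^ (n + 2) * y powi (r * (int n + 2) - t) - x powi t * c ^ (n + 2))
       + 1 / (real n + 1) * p * x powi (s + t) * c ^ (n + 1)"
proof -
  have x0: "x \<noteq> 0" and y0: "y \<noteq> 0" using xy by auto
  \<comment> \<open>The sign \<open>(-1) powi (r * (int n - int k))\<close> is what turns the power
    of \<open>y\<close> into a power of \<open>x\<close>, so that all exponents merge into
    one.\<close>
  have summand: "real (n choose k) * (1 / (real k + 2))
         * (-1) powi (r * (int n - int k)) * p ^ (k + 2) * q ^ (n - k)
         * x powi (s * (int k + 2) - r * (int n - int k) + t)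
      = x powi t * (real (n choose k) / (real k + 2)
         * (p * x powi s) ^ (k + 2) * (q * y powi r) ^ (n - k))"
    if "k \<le> n" for k
  proof -
    have "(x powi s) ^ (k + 2) = x powi (s * (int k + 2))"
      by (metis of_nat_add of_nat_numeral power_int_mult power_int_of_nat)
    moreover have "(y powi r) ^ (n - k) = y powi (r * (int n - int k))"
      using that by (metis of_nat_diff power_int_mult power_int_of_nat)
    moreover have "\<dots> = (-1) powi (r * (int n - int k)) * x powi (- (r * (int n - int k)))"
      by (rule powi_conjugate [OF xy])
    moreover have "x powi (s * (int k + 2) - r * (int n - int k) + t)
        = x powi (s * (int k + 2)) * x powi (- (r * (int n - int k))) * x powi t"
      using x0 by (simp flip: power_int_add)
    ultimately show ?thesis
      by (simp only: power_mult_distrib) (simp add: mult_ac)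
  qed
  \<comment> \<open>Here the conversion goes the other way: \<open>x powi t\<close> becomes a power
    of \<open>y\<close>, which produces the sign \<open>(-1) powi t\<close> and the index
    \<open>r * (int n + 2) - t\<close>.\<close>
  have "(q * y powi r) ^ (n + 2) * x powi t
      = (-1) powi t * q ^ (n + 2) * y powi (r * (int n + 2) - t)"
  proof -
    have "(y powi r) ^ (n + 2) = y powi (r * (int n + 2))"
      by (metis of_nat_add of_nat_numeral power_int_mult power_int_of_nat)
    moreover have "x powi t = (-1) powi t * y powi (- t)"
      using powi_conjugate [of y x t] xy by (simp add: mult.commute)
    ultimately show ?thesis
      using power_int_add [of y "r * (int n + 2)" "- t"] y0
      by (simp only: power_mult_distrib) (simp add: mult_ac)
  qed
  moreover have "x powi (s + t) = x powi s * x powi t"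
    using x0 by (simp add: power_int_add)
  moreover have "(\<Sum>k=0..n. real (n choose k) * (1 / (real k + 2))
         * (-1) powi (r * (int n - int k)) * p ^ (k + 2) * q ^ (n - k)
         * x powi (s * (int k + 2) - r * (int n - int k) + t))
      = x powi t * (((q * y powi r) ^ (n + 2) - c ^ (n + 2)) / ((real n + 1) * (real n + 2))
         + (p * x powi s) * c ^ (n + 1) / (real n + 1))"
    unfolding c sum_binomial_div_add2 [symmetric] sum_distrib_left atMost_atLeast0
    by (intro sum.cong refl summand) simp
  ultimately show ?thesis
    by (simp add: algebra_simps diff_divide_distrib)
qed

text \<open>Induction on pairs of consecutive values, in both directions from 0; the downward step
  solves the recurrence for its last term. This carries Binet's formula to negative indices.\<close>

lemma fib_recurrence_unique:
  fixes f g :: "int \<Rightarrow> real"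
  assumes f: "\<And>m. f m = f (m - 1) + f (m - 2)" and g: "\<And>m. g m = g (m - 1) + g (m - 2)"
    and "f 0 = g 0" "f 1 = g 1"
  shows "f m = g m"
proof -
  have "f m = g m \<and> f (m + 1) = g (m + 1)"
  proof (induction m rule: int_induct [where k = 0])
    case (step1 i)
    then show ?case using f [of "i + 2"] g [of "i + 2"] by (simp add: add.commute)
  next
    case (step2 i)
    then show ?case using f [of "i + 1"] g [of "i + 1"] by simp
  qed (use assms(3,4) in simp)
  then show ?thesis ..
qed

abbreviation phi :: real where "phi \<equiv> (1 + sqrt 5) / 2"
abbreviation psi :: real where "psi \<equiv> (1 - sqrt 5) / 2"

lemma phi_psi: "phi * psi = -1"
  by (simp add: field_simps)

lemma phi_neq_0: "phi \<noteq> 0" and psi_neq_0: "psi \<noteq> 0"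
  using phi_psi by auto

lemma powi_fib_recurrence:
  fixes x :: real
  assumes "x\<^sup>2 = x + 1"
  shows "x powi m = x powi (m - 1) + x powi (m - 2)"
proof -
  have x0: "x \<noteq> 0" using assms by auto
  have "x powi m = x powi (m - 2) * x\<^sup>2"
    using power_int_add [of x "m - 2" 2] x0 by simp
  also have "\<dots> = x powi (m - 2) * x + x powi (m - 2)"
    by (simp add: assms distrib_left)
  also have "x powi (m - 2) * x = x powi (m - 1)"
    using power_int_add_1 [of x "m - 2"] x0 by simp
  finally show ?thesis .
qed

lemma phi_powi_rec: "phi powi m = phi powi (m - 1) + phi powi (m - 2)"
  by (rule powi_fib_recurrence) (simp add: power2_eq_square field_simps)

lemma psi_powi_rec: "psi powi m = psi powi (m - 1) + psi powi (m - 2)"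
  by (rule powi_fib_recurrence) (simp add: power2_eq_square field_simps)

lemma fibz_Binet: "real_of_int (fibz m) = (phi powi m - psi powi m) / sqrt 5"
proof (rule fib_recurrence_unique)
  show "real_of_int (fibz m) = real_of_int (fibz (m - 1)) + real_of_int (fibz (m - 2))" for m
    by (metis fibz_rec of_int_add)
  show "(phi powi m - psi powi m) / sqrt 5 = (phi powi (m - 1) - psi powi (m - 1)) / sqrt 5
      + (phi powi (m - 2) - psi powi (m - 2)) / sqrt 5" for m
    unfolding phi_powi_rec [of m] psi_powi_rec [of m] by (simp add: add_divide_distrib diff_divide_distrib)
qed (simp_all add: field_simps)

lemma lucasz_Binet: "real_of_int (lucasz m) = phi powi m + psi powi m"
proof (rule fib_recurrence_unique)
  show "real_of_int (lucasz m) = real_of_int (lucasz (m - 1)) + real_of_int (lucasz (m - 2))" for m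
    by (metis lucasz_rec of_int_add)
  show "phi powi m + psi powi m = (phi powi (m - 1) + psi powi (m - 1))
      + (phi powi (m - 2) + psi powi (m - 2))" for m
    unfolding phi_powi_rec [of m] psi_powi_rec [of m] by simp
qed (simp_all add: field_simps)

text \<open>After Binet's formula is inserted, the mixed products
  \<open>phi powi s * psi powi r\<close> (respectively \<open>psi powi s * phi powi r\<close>)
  cancel.\<close>

lemma fibz_add_phi: "real_of_int (fibz (r + s)) = fibz r * phi powi s + fibz s * psi powi r"
  and fibz_add_psi: "real_of_int (fibz (r + s)) = fibz r * psi powi s + fibz s * phi powi r"
  unfolding fibz_Binet power_int_add [OF disjI1 [OF phi_neq_0]] power_int_add [OF disjI1 [OF psi_neq_0]]
  by (simp_all only: divide_inverse) algebra+

theorem theorem12: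
  fixes r s t :: int and n :: nat
  shows
    "(\<Sum>k=0..n. real (n choose k) * (1 / (real k + 2))
         * (-1) powi (r * (int n - int k))
         * real_of_int (fibz r) ^ (k + 2) * real_of_int (fibz s) ^ (n - k)
         * real_of_int (fibz (s * (int k + 2) - r * (int n - int k) + t)))
     = 1 / ((real n + 1) * (real n + 2))
         * ((-1) powi (t + 1) * real_of_int (fibz s) ^ (n + 2)
              * real_of_int (fibz (r * (int n + 2) - t))
            - real_of_int (fibz t) * real_of_int (fibz (r + s)) ^ (n + 2))
       + 1 / (real n + 1) * real_of_int (fibz r) * real_of_int (fibz (s + t))
         * real_of_int (fibz (r + s)) ^ (n + 1)
     \<and>
     (\<Sum>k=0..n. real (n choose k) * (1 / (real k + 2))
         * (-1) powi (r * (int n - int k))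
         * real_of_int (fibz r) ^ (k + 2) * real_of_int (fibz s) ^ (n - k)
         * real_of_int (lucasz (s * (int k + 2) - r * (int n - int k) + t)))
     = 1 / ((real n + 1) * (real n + 2))
         * ((-1) powi t * real_of_int (fibz s) ^ (n + 2)
              * real_of_int (lucasz (r * (int n + 2) - t))
            - real_of_int (lucasz t) * real_of_int (fibz (r + s)) ^ (n + 2))
       + 1 / (real n + 1) * real_of_int (fibz r) * real_of_int (lucasz (s + t))
         * real_of_int (fibz (r + s)) ^ (n + 1)"
proof -
  \<comment> \<open>None of the abbreviations involves \<open>phi\<close> or \<open>psi\<close>, so
    the two conjugate identities below share them and can be combined linearly.\<close>
  define w where "w k = real (n choose k) * (1 / (real k + 2)) * (-1) powi (r * (int n - int k))
      * real_of_int (fibz r) ^ (k + 2) * real_of_int (fibz s) ^ (n - k)" for k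
  define e where "e k = s * (int k + 2) - r * (int n - int k) + t" for k
  define A where "A = 1 / ((real n + 1) * (real n + 2))"
  define B where "B = 1 / (real n + 1) * real_of_int (fibz r)"
  define c where "c = real_of_int (fibz (r + s))"
  define d where "d = (-1) powi t * real_of_int (fibz s) ^ (n + 2)"
  define m where "m = r * (int n + 2) - t"
  have psi_phi: "psi * phi = -1"
    using phi_psi by (simp only: mult.commute)
  have phi_sum: "(\<Sum>k=0..n. w k * phi powi e k)
      = A * (d * psi powi m - phi powi t * c ^ (n + 2)) + B * phi powi (s + t) * c ^ (n + 1)"
    unfolding w_def e_def A_def B_def d_def m_def c_def
    by (rule sum_binomial_powi [OF phi_psi fibz_add_phi])
  have psi_sum: "(\<Sum>k=0..n. w k * psi powi e k)
      = A * (d * phi powi m - psi powi t * c ^ (n + 2)) + B * psi powi (s + t) * c ^ (n + 1)"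
    unfolding w_def e_def A_def B_def d_def m_def c_def
    by (rule sum_binomial_powi [OF psi_phi fibz_add_psi])
  have "(\<Sum>k=0..n. w k * real_of_int (fibz (e k)))
      = ((\<Sum>k=0..n. w k * phi powi e k) - (\<Sum>k=0..n. w k * psi powi e k)) / sqrt 5"
    by (simp only: fibz_Binet sum_subtractf [symmetric] sum_divide_distrib right_diff_distrib
        times_divide_eq_right)
  \<comment> \<open>In \<open>phi_sum\<close> the factor \<open>d\<close> goes with
    \<open>psi powi m\<close>, and in \<open>psi_sum\<close> with \<open>phi powi m\<close>. The
    difference therefore reverses the sign of \<open>d\<close>, whereas the sum in the Lucas case
    keeps it.\<close>
  also have "\<dots> = A * (- d * real_of_int (fibz m) - real_of_int (fibz t) * c ^ (n + 2))
      + B * real_of_int (fibz (s + t)) * c ^ (n + 1)"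
    unfolding phi_sum psi_sum fibz_Binet
    by (simp only: divide_inverse) algebra
  finally have fib_part: "(\<Sum>k=0..n. w k * real_of_int (fibz (e k)))
      = A * (- d * real_of_int (fibz m) - real_of_int (fibz t) * c ^ (n + 2))
      + B * real_of_int (fibz (s + t)) * c ^ (n + 1)" .
  have "(\<Sum>k=0..n. w k * real_of_int (lucasz (e k)))
      = (\<Sum>k=0..n. w k * phi powi e k) + (\<Sum>k=0..n. w k * psi powi e k)"
    by (simp only: lucasz_Binet sum.distrib [symmetric] distrib_left)
  also have "\<dots> = A * (d * real_of_int (lucasz m) - real_of_int (lucasz t) * c ^ (n + 2))
      + B * real_of_int (lucasz (s + t)) * c ^ (n + 1)"
    unfolding phi_sum psi_sum lucasz_Binet by algebra
  finally have lucas_part: "(\<Sum>k=0..n. w k * real_of_int (lucasz (e k)))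
      = A * (d * real_of_int (lucasz m) - real_of_int (lucasz t) * c ^ (n + 2))
      + B * real_of_int (lucasz (s + t)) * c ^ (n + 1)" .
  \<comment> \<open>The reversed sign accounts for the exponent \<open>t + 1\<close> in the
    Fibonacci identity.\<close>
  have "- d = (-1) powi (t + 1) * real_of_int (fibz s) ^ (n + 2)"
    by (simp add: d_def power_int_add)
  then show ?thesis
    using fib_part lucas_part
    unfolding w_def e_def A_def B_def c_def m_def by (simp only: d_def)
qed

end
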